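(* Let $r,s>0$ and $p\in(0,1)$ be constants. Let $X\sim\mathrm{Binomial}(n,p)$ and let $Y\sim\mathrm{Binomial}(m,p)$ be independent of $X$. Define $$R=\frac{X^s}{(X+Y)^r}.$$ Then as $n,m\rightarrow\infty$, we have the following convergences in distribution: (i) If $m/n\rightarrow\infty$ and $m\log(m)\,n^{-3/2}\rightarrow 0$, then $$\frac{m^r}{n^{s-1/2}}\left(R-\frac{n^s}{(n+m)^r}p^{s-r}\right)\rightarrow \mathcal{N}\left(0,\;p^{2(s-r)-1}(1-p)s^2\right).$$ (ii) If $m/n\rightarrow\alpha\in(0,+\infty)$, then $$n^{r-s+1/2}\left(R-\frac{n^s}{(n+m)^r}p^{s-r}\right)\rightarrow \mathcal{N}\left(0,\;p^{2(s-r)-1}(1-p)\frac{(s(1+\alpha)-r)^2+\alpha r^2}{(1+\alpha)^{2(r+1)}}\right).$$ (iii) If $m/n\rightarrow 0$, then $$n^{r-s+1/2}\left(R-\frac{n^s}{(n+m)^r}p^{s-r}\right)\rightarrow \mathcal{N}\left(0,\;p^{2(s-r)-1}(1-p)(s-r)^2\right).$$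
   Context: $\mathrm{Binomial}(n,p)$ is the number of successes in $n$ independent trials with success probability $p$. $\mathcal{N}(\mu,\sigma^2)$ is the Normal distribution with mean $\mu$ and variance $\sigma^2$; when $\sigma^2=0$ (which occurs in case (iii) when $r=s$) it is understood as the point mass at $\mu$. The limits are taken along any sequence of pairs of positive integers $(n,m)$ with $n\to\infty$ and $m\to\infty$ satisfying the stated condition on the growth of $m$ relative to $n$; $X$, $Y$ and $R$ depend on $(n,m)$, while $r,s,p$ are fixed. The ratio $R$ is defined on the event $X+Y>0$, whose probability tends to $1$; on the event $X+Y=0$ it may be assigned any fixed value (for example $0$). *)

theory Defs
  imports "HOL-Probability.Probability"
begin

text \<open>The second parameter is the variance, whereas \<^const>\<open>normal_density\<close>
  takes the standard deviation. For variance 0 the law is the point mass at the mean.\<close>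

definition normal_law :: "real \<Rightarrow> real \<Rightarrow> real measure" where
  "normal_law \<mu> v =
     (if v = 0 then return borel \<mu> else density lborel (normal_density \<mu> (sqrt v)))"

text \<open>The parameter \<open>c\<close> is the arbitrary value given to the ratio where its denominator
  vanishes.\<close>

definition ratio :: "real \<Rightarrow> real \<Rightarrow> real \<Rightarrow> nat \<Rightarrow> nat \<Rightarrow> real" where
  "ratio c r s x y = (if x + y = 0 then c else real x powr s / real (x + y) powr r)"

end

theory Submission
  imports Defs
begin

text \<open>
  With \<open>u = X / (n p)\<close> and \<open>v = (X + Y) / ((n + m) p)\<close> the ratio is its centering times
  \<open>u\<^sup>s / v\<^sup>r\<close>, and in all three regimes the normalization turns the statement into one about
  \<open>d \<surd>n (u\<^sup>s / v\<^sup>r - 1)\<close> with a convergent factor \<open>d\<close>. Linearizing at \<open>(1, 1)\<close> replaces this by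
  \<open>d \<surd>n (s (u - 1) - r (v - 1))\<close>, a linear combination of the two independent standardized
  binomials. Its coefficients converge as soon as \<open>n / (n + m)\<close> does, so its characteristic
  function tends to a Gaussian one; the linearization error in the characteristic function is
  controlled by first absolute moments.
\<close>

section \<open>Characteristic functions of the limit laws\<close>

lemma cmod_iexp_diff_le: "cmod (iexp a - iexp b) \<le> \<bar>a - b\<bar>"
proof -
  have "iexp a - iexp b = iexp b * (iexp (a - b) - 1)"
    by (simp add: algebra_simps flip: exp_add)
  then have "cmod (iexp a - iexp b) = cmod (iexp (a - b) - 1)"
    by (simp add: norm_mult)
  also have "\<dots> \<le> \<bar>a - b\<bar>"
    using iexp_approx1[of "a - b" 0] by simp
  finally show ?thesis .
qed

lemma prob_space_normal_law: "0 \<le> v \<Longrightarrow> prob_space (normal_law \<mu> v)"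
  by (auto simp: normal_law_def intro: prob_space_normal_density prob_space_return)

lemma real_distribution_normal_law: "0 \<le> v \<Longrightarrow> real_distribution (normal_law \<mu> v)"
  unfolding real_distribution_def real_distribution_axioms_def
  by (simp add: prob_space_normal_law) (simp add: normal_law_def)

text \<open>For positive \<open>v\<close> the law is the image of the standard normal law under
  scaling by \<open>sqrt v\<close>. Variance 0 is the point mass at 0, with constant characteristic
  function 1, so one formula covers both cases.\<close>

lemma char_normal_law:
  assumes "0 \<le> v"
  shows "char (normal_law 0 v) t = exp (- (v * t\<^sup>2 / 2))"
proof (cases "v = 0")
  case True
  then show ?thesis by (simp add: normal_law_def char_def integral_return)
next
  case False
  with assms have v: "0 < v" by simp
  interpret N: prob_space std_normal_distribution
    by (rule prob_space_normal_density) simp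
  have "distributed std_normal_distribution lborel (\<lambda>x. x) std_normal_density"
    by (simp add: distributed_def distr_id2)
  from N.normal_density_affine[OF this, of "sqrt v" 0]
  have "distributed std_normal_distribution lborel (\<lambda>x. sqrt v * x) (normal_density 0 (sqrt v))"
    using v by simp
  then have *: "normal_law 0 v = distr std_normal_distribution lborel (\<lambda>x. sqrt v * x)"
    using v by (simp add: distributed_def normal_law_def)
  have "char (normal_law 0 v) t = char std_normal_distribution (t * sqrt v)"
    by (simp add: * char_def integral_distr mult.assoc)
  also have "\<dots> = exp (- (v * t\<^sup>2 / 2))"
    using v by (simp add: char_std_normal_distribution power_mult_distrib mult.commute)
  finally show ?thesis .
qed

section \<open>Moments and central limit theorem for the standardized binomial\<close>

definition std_binomial :: "real \<Rightarrow> nat \<Rightarrow> nat \<Rightarrow> real" where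
  "std_binomial p n k = (real k - real n * p) / sqrt (real n * p * (1 - p))"

lemma std_binomial_second_moment:
  assumes p: "0 < p" "p < 1" and n: "0 < n"
  shows "measure_pmf.expectation (binomial_pmf n p) (\<lambda>k. (std_binomial p n k)\<^sup>2) = 1"
proof -
  \<comment> \<open>The square is expanded in \<open>k * (k - 1)\<close>, \<open>k\<close> and 1,
    whose sums against the Bernstein weights are known.\<close>
  have "(\<Sum>k\<le>n. Bernstein n k p * (real k - real n * p)\<^sup>2)
      = (\<Sum>k\<le>n. real k * (real k - 1) * Bernstein n k p)
        + (1 - 2 * real n * p) * (\<Sum>k\<le>n. real k * Bernstein n k p)
        + (real n * p)\<^sup>2 * (\<Sum>k\<le>n. Bernstein n k p)"
    unfolding sum_distrib_left sum.distrib[symmetric]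
    by (intro sum.cong refl) (simp add: algebra_simps power2_eq_square)
  also have "\<dots> = real n * p * (1 - p)"
    by (simp only: sum_kk_Bernstein sum_k_Bernstein sum_Bernstein)
       (simp add: algebra_simps power2_eq_square)
  finally show ?thesis
    using p n
    by (subst expectation_binomial_pmf')
       (simp_all add: std_binomial_def Bernstein_def power_divide sum_divide_distrib[symmetric])
qed

text \<open>Follows from the unit second moment through |x| \<le> (1 + x^2) / 2. The bound is
  uniform in \<open>n\<close>; it later controls both the variation of coefficients and the
  linearization error.\<close>

lemma std_binomial_abs_moment_le:
  assumes p: "0 < p" "p < 1" and n: "0 < n"
  shows "measure_pmf.expectation (binomial_pmf n p) (\<lambda>k. \<bar>std_binomial p n k\<bar>) \<le> 1"
proof -
  have "measure_pmf.expectation (binomial_pmf n p) (\<lambda>k. \<bar>std_binomial p n k\<bar>)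
      \<le> measure_pmf.expectation (binomial_pmf n p) (\<lambda>k. (1 + (std_binomial p n k)\<^sup>2) / 2)"
  proof (intro integral_mono)
    fix k
    show "\<bar>std_binomial p n k\<bar> \<le> (1 + (std_binomial p n k)\<^sup>2) / 2"
      using zero_le_power2[of "\<bar>std_binomial p n k\<bar> - 1"] by (simp add: power2_diff)
  qed (use p in auto)
  also have "\<dots> = 1"
    using p std_binomial_second_moment[OF p n] by (simp add: Bochner_Integration.integral_add)
  finally show ?thesis .
qed

text \<open>The centred count is a sum of \<open>n\<close> independent trials worth
  \<open>1 - p\<close> or \<open>- p\<close>. On the level of the binomial weights this
  factorization is the binomial theorem.\<close>

lemma std_binomial_char:
  assumes p: "0 < p" "p < 1"
  shows "measure_pmf.expectation (binomial_pmf n p) (\<lambda>k. iexp (t * std_binomial p n k))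
    = ((1 - p) * iexp (- (t / sqrt (real n * p * (1 - p)) * p))
        + p * iexp (t / sqrt (real n * p * (1 - p)) * (1 - p))) ^ n"
proof -
  define u where "u = t / sqrt (real n * p * (1 - p))"
  have "(p * iexp (u * (1 - p)) + (1 - p) * iexp (- (u * p))) ^ n =
     (\<Sum>k\<le>n. of_nat (n choose k) * (p * iexp (u * (1 - p))) ^ k
                 * ((1 - p) * iexp (- (u * p))) ^ (n - k))"
    by (rule binomial_ring)
  also have "\<dots> = (\<Sum>k\<le>n. (real (n choose k) * p ^ k * (1 - p) ^ (n - k)) *\<^sub>R
        iexp (t * std_binomial p n k))"
  proof (intro sum.cong refl)
    fix k assume "k \<in> {..n}"
    then have k: "real (n - k) = real n - real k" by simp
    have "iexp (u * (1 - p)) ^ k * iexp (- (u * p)) ^ (n - k)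
        = iexp (real k * (u * (1 - p)) + real (n - k) * (- (u * p)))"
      unfolding of_real_add distrib_left exp_add
      by (simp add: exp_of_nat_mult[symmetric] mult_ac)
    also have "real k * (u * (1 - p)) + real (n - k) * (- (u * p)) = t * std_binomial p n k"
      unfolding k by (simp add: u_def std_binomial_def diff_divide_distrib algebra_simps)
    finally show "of_nat (n choose k) * (p * iexp (u * (1 - p))) ^ k
          * ((1 - p) * iexp (- (u * p))) ^ (n - k)
        = (real (n choose k) * p ^ k * (1 - p) ^ (n - k)) *\<^sub>R iexp (t * std_binomial p n k)"
      by (simp add: power_mult_distrib scaleR_conv_of_real mult_ac)
  qed
  finally show ?thesis
    using p by (subst expectation_binomial_pmf') (simp_all add: u_def add.commute)
qed

text \<open>The one-trial characteristic function \<open>\<psi> n\<close> is compared with its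
  second-order Taylor value \<open>w n\<close>. Once both lie in the unit disc, their
  \<open>n\<close>-th powers differ by at most \<open>n\<close> times a third-order error, which is
  of order 1 / sqrt n, and \<open>w n ^ n\<close> tends to the Gaussian value.\<close>

lemma std_binomial_char_tendsto:
  assumes p: "0 < p" "p < 1"
  shows "(\<lambda>n. measure_pmf.expectation (binomial_pmf n p) (\<lambda>k. iexp (t * std_binomial p n k)))
    \<longlonglongrightarrow> exp (- (t\<^sup>2 / 2))"
proof -
  define q where "q = 1 - p"
  have q: "0 < q" "p + q = 1" using p by (auto simp: q_def)
  define u where "u n = t / sqrt (real n * p * q)" for n
  define \<psi> where "\<psi> n = q * iexp (- (u n * p)) + p * iexp (u n * q)" for n
  define w where "w n = complex_of_real (1 - (t\<^sup>2 / 2) / n)" for n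
  have cube: "cmod (iexp x - (1 + \<i> * x - x\<^sup>2 / 2)) \<le> \<bar>x\<bar> ^ 3 / 6" for x :: real
    using iexp_approx1[of x 2]
    by (simp add: numeral_eq_Suc power_mult_distrib)
  have \<psi>_le: "cmod (\<psi> n) \<le> 1" for n
    unfolding \<psi>_def using p q
    by (intro order.trans[OF norm_triangle_ineq]) (simp add: norm_mult)
  \<comment> \<open>The threshold on \<open>n\<close> gives 1 - t^2 / (2 n) \<ge> -1, so that
    \<open>w n\<close> lies in the unit disc. The constant comes from n |u|^3 / 3 together with n
    u^2 = t^2 / (p q).\<close>
  have bound: "cmod (\<psi> n ^ n - w n ^ n) \<le> t\<^sup>2 / (3 * p * q) * \<bar>u n\<bar>"
    if n: "real n \<ge> t\<^sup>2 / 4" "0 < n" for n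
  proof -
    have "u n ^ 2 * p * q = t\<^sup>2 / n"
      using p q n by (simp add: u_def power_divide)
    then have w: "w n = 1 - complex_of_real ((u n)\<^sup>2 * p * q) / 2"
      by (simp add: w_def)
    \<comment> \<open>The first-order terms cancel because a trial is centred, and the second-order
      terms combine by q p^2 + p q^2 = p q. The identity is checked for arbitrary complex numbers
      with \<open>1 - Q\<close> in place of \<open>p\<close>, which builds p + q = 1 into the
      algebra.\<close>
    have "\<psi> n - w n = q * (iexp (- (u n * p)) - (1 + \<i> * complex_of_real (- (u n * p)) - (- (u n * p))\<^sup>2 / 2))
        + p * (iexp (u n * q) - (1 + \<i> * complex_of_real (u n * q) - (u n * q)\<^sup>2 / 2))"
    proof -
      have "Q * x + (1 - Q) * y - (1 - U\<^sup>2 * (1 - Q) * Q / 2)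
          = Q * (x - (1 + \<i> * (- (U * (1 - Q))) - (- (U * (1 - Q)))\<^sup>2 / 2))
            + (1 - Q) * (y - (1 + \<i> * (U * Q) - (U * Q)\<^sup>2 / 2))" for Q U x y :: complex
        by (simp add: field_simps power2_eq_square)
      moreover have "complex_of_real p = 1 - complex_of_real q"
        using q(2) by (simp add: complex_eq_iff)
      ultimately show ?thesis
        unfolding w \<psi>_def by simp
    qed
    also have "cmod \<dots> \<le> q * (\<bar>- (u n * p)\<bar> ^ 3 / 6) + p * (\<bar>u n * q\<bar> ^ 3 / 6)"
      using p q
      by (intro order.trans[OF norm_triangle_ineq] add_mono)
         (simp_all only: norm_mult norm_of_real abs_of_pos mult_le_cancel_left_pos cube)
    also have "\<dots> \<le> 1 * (\<bar>u n\<bar> ^ 3 / 6) + 1 * (\<bar>u n\<bar> ^ 3 / 6)"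
      using p q
      by (intro add_mono mult_mono divide_right_mono power_mono)
         (auto simp: abs_mult intro!: mult_left_le)
    finally have "cmod (\<psi> n - w n) \<le> \<bar>u n\<bar> ^ 3 / 3" by simp
    moreover have "cmod (w n) \<le> 1"
    proof -
      have "t\<^sup>2 / 2 / n \<le> 2" using n by (simp add: field_simps)
      then show ?thesis unfolding w_def norm_of_real by (simp add: abs_le_iff)
    qed
    then have "cmod (\<psi> n ^ n - w n ^ n) \<le> real n * cmod (\<psi> n - w n)"
      by (intro norm_power_diff \<psi>_le)
    ultimately have "cmod (\<psi> n ^ n - w n ^ n) \<le> real n * (\<bar>u n\<bar> ^ 3 / 3)"
      by (meson mult_left_mono of_nat_0_le_iff order_trans)
    also have "\<dots> = t\<^sup>2 / (3 * p * q) * \<bar>u n\<bar>"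
    proof -
      have "real n * (u n)\<^sup>2 = t\<^sup>2 / (p * q)"
        using p q n by (simp add: u_def power_divide)
      moreover have "\<bar>u n\<bar> ^ 3 = (u n)\<^sup>2 * \<bar>u n\<bar>"
        by (simp add: numeral_eq_Suc)
      ultimately show ?thesis
        by (simp add: mult.assoc[symmetric])
    qed
    finally show ?thesis .
  qed
  have "u \<longlonglongrightarrow> 0"
  proof -
    have "filterlim (\<lambda>n. sqrt (real n * (p * q))) at_top sequentially"
      using p q
      by (intro filterlim_compose[OF sqrt_at_top]
                filterlim_tendsto_pos_mult_at_top[OF tendsto_const _ filterlim_real_sequentially,
                  of "p * q", unfolded mult.commute[of "p * q"]]) auto
    then show ?thesis
      unfolding u_def mult.assoc
      by (intro tendsto_divide_0[OF tendsto_const] filterlim_at_top_imp_at_infinity)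
  qed
  then have "(\<lambda>n. t\<^sup>2 / (3 * p * q) * \<bar>u n\<bar>) \<longlonglongrightarrow> 0"
    using p q by (auto intro!: tendsto_eq_intros)
  moreover have "\<forall>\<^sub>F n in sequentially. cmod (\<psi> n ^ n - w n ^ n) \<le> t\<^sup>2 / (3 * p * q) * \<bar>u n\<bar>"
    using eventually_ge_at_top[of "nat \<lceil>t\<^sup>2 / 4\<rceil>"] eventually_gt_at_top[of 0]
    by eventually_elim (intro bound; linarith)
  ultimately have "(\<lambda>n. \<psi> n ^ n - w n ^ n) \<longlonglongrightarrow> 0"
    by (rule Lim_null_comparison[rotated])
  moreover have "(\<lambda>n. w n ^ n) \<longlonglongrightarrow> exp (- (t\<^sup>2 / 2))"
  proof -
    have "(\<lambda>n. complex_of_real ((1 + (- (t\<^sup>2 / 2)) / n) ^ n)) \<longlonglongrightarrow> complex_of_real (exp (- (t\<^sup>2 / 2)))"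
      by (intro tendsto_of_real tendsto_exp_limit_sequentially)
    then show ?thesis by (simp add: w_def)
  qed
  ultimately have "(\<lambda>n. \<psi> n ^ n) \<longlonglongrightarrow> exp (- (t\<^sup>2 / 2))"
    using tendsto_add by fastforce
  then show ?thesis
    by (simp only: std_binomial_char[OF p] \<psi>_def u_def q_def of_real_diff of_real_1)
qed

section \<open>Linearization of the power ratio at (1, 1)\<close>

lemma powr_ratio_linearization:
  fixes r s \<eta> :: real
  assumes "0 < \<eta>"
  obtains \<delta> where "0 < \<delta>" "\<delta> < 1"
    "\<And>x y. \<bar>x - 1\<bar> < \<delta> \<Longrightarrow> \<bar>y - 1\<bar> < \<delta> \<Longrightarrow>
       \<bar>x powr s / y powr r - 1 - (s * (x - 1) - r * (y - 1))\<bar> \<le> \<eta> * (\<bar>x - 1\<bar> + \<bar>y - 1\<bar>)"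
proof -
  \<comment> \<open>Total differentiability at (1, 1), with gradient (s, -r), is the desired error
    bound up to the choice of norm.\<close>
  have "((\<lambda>z. fst z powr s * snd z powr (- r)) has_derivative
          (\<lambda>h. s * fst h - r * snd h)) (at (1 :: real, 1 :: real))"
    by (auto intro!: derivative_eq_intros)
  then obtain d where d: "0 < d" and lin:
    "\<And>z. norm (z - (1, 1)) < d \<Longrightarrow> 
      norm (fst z powr s * snd z powr (- r) - 1 - (s * fst (z - (1, 1)) - r * snd (z - (1, 1)))) 
        \<le> \<eta> * norm (z - (1 :: real, 1 :: real))"
    using assms unfolding has_derivative_at_alt by fastforce
  show ?thesis
  proof
    \<comment> \<open>The bound \<open>d / 2\<close> on each coordinate keeps the norm of the pair
      below \<open>d\<close>; the bound \<open>1 / 2\<close> keeps \<delta> below 1, so that numbers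
      within \<delta> of 1 are positive.\<close>
    show "0 < min (d / 2) (1 / 2)" "min (d / 2) (1 / 2) < (1 :: real)" using d by auto
    fix x y :: real
    assume "\<bar>x - 1\<bar> < min (d / 2) (1 / 2)" "\<bar>y - 1\<bar> < min (d / 2) (1 / 2)"
    moreover have le: "norm ((x, y) - (1, 1)) \<le> \<bar>x - 1\<bar> + \<bar>y - 1\<bar>"
      using norm_Pair_le[of "x - 1" "y - 1"] by simp
    ultimately have "norm ((x, y) - (1, 1)) < d" by linarith
    from lin[OF this] have "\<bar>x powr s / y powr r - 1 - (s * (x - 1) - r * (y - 1))\<bar>
        \<le> \<eta> * norm ((x, y) - (1, 1))"
      by (simp add: powr_minus divide_inverse)
    also have "\<dots> \<le> \<eta> * (\<bar>x - 1\<bar> + \<bar>y - 1\<bar>)"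
      using le assms by simp
    finally show "\<bar>x powr s / y powr r - 1 - (s * (x - 1) - r * (y - 1))\<bar>
        \<le> \<eta> * (\<bar>x - 1\<bar> + \<bar>y - 1\<bar>)" .
  qed
qed

section \<open>Central limit theorem with convergent coefficients\<close>

lemma std_binomial_char_tendsto_compose:
  assumes p: "0 < p" "p < 1"
    and n: "\<And>k. 0 < n k" "filterlim n at_top sequentially"
    and a: "a \<longlonglongrightarrow> \<alpha>"
  shows "(\<lambda>k. measure_pmf.expectation (binomial_pmf (n k) p) (\<lambda>j. iexp (a k * std_binomial p (n k) j)))
    \<longlonglongrightarrow> exp (- (\<alpha>\<^sup>2 / 2))"
proof -
  let ?E = "\<lambda>k. measure_pmf.expectation (binomial_pmf (n k) p)"
  let ?S = "\<lambda>k. std_binomial p (n k)"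
  \<comment> \<open>Replacing \<open>a k\<close> by its limit costs at most |a k - \<alpha>|, since
    \<open>iexp\<close> is 1-Lipschitz and the first absolute moment is at most 1. After that only
    the sample size varies.\<close>
  have "(\<lambda>k. ?E k (\<lambda>j. iexp (a k * ?S k j)) - ?E k (\<lambda>j. iexp (\<alpha> * ?S k j))) \<longlonglongrightarrow> 0"
  proof (rule Lim_null_comparison)
    show "(\<lambda>k. \<bar>a k - \<alpha>\<bar>) \<longlonglongrightarrow> 0"
      using a by (simp add: LIM_zero_iff tendsto_rabs_zero_iff)
    have "cmod (?E k (\<lambda>j. iexp (a k * ?S k j)) - ?E k (\<lambda>j. iexp (\<alpha> * ?S k j))) \<le> \<bar>a k - \<alpha>\<bar>" for k
    proof -
      have "cmod (?E k (\<lambda>j. iexp (a k * ?S k j)) - ?E k (\<lambda>j. iexp (\<alpha> * ?S k j)))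
          = cmod (?E k (\<lambda>j. iexp (a k * ?S k j) - iexp (\<alpha> * ?S k j)))"
        using p by (subst Bochner_Integration.integral_diff) auto
      also have "\<dots> \<le> ?E k (\<lambda>j. cmod (iexp (a k * ?S k j) - iexp (\<alpha> * ?S k j)))"
        by (rule integral_norm_bound)
      also have "\<dots> \<le> ?E k (\<lambda>j. \<bar>a k - \<alpha>\<bar> * \<bar>?S k j\<bar>)"
      proof (intro integral_mono)
        fix j
        show "cmod (iexp (a k * ?S k j) - iexp (\<alpha> * ?S k j)) \<le> \<bar>a k - \<alpha>\<bar> * \<bar>?S k j\<bar>"
          using cmod_iexp_diff_le[of "a k * ?S k j" "\<alpha> * ?S k j"]
          by (simp add: left_diff_distrib[symmetric] abs_mult)
      qed (use p in auto)
      also have "\<dots> \<le> \<bar>a k - \<alpha>\<bar>"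
        using std_binomial_abs_moment_le[OF p n(1)[of k]] by (simp add: mult_left_le)
      finally show ?thesis .
    qed
    then show "\<forall>\<^sub>F k in sequentially.
        cmod (?E k (\<lambda>j. iexp (a k * ?S k j)) - ?E k (\<lambda>j. iexp (\<alpha> * ?S k j))) \<le> \<bar>a k - \<alpha>\<bar>"
      by simp
  qed
  from tendsto_add[OF this filterlim_compose[OF std_binomial_char_tendsto[OF p, of \<alpha>] n(2)]]
  show ?thesis by simp
qed

section \<open>Random variables with binomial laws and the limit theorem for their ratio\<close>

lemma (in prob_space) expectation_binomial:
  fixes f :: "nat \<Rightarrow> 'b :: {banach, second_countable_topology}"
  assumes "X \<in> measurable M (count_space UNIV)"
    and "distr M (count_space UNIV) X = measure_pmf (binomial_pmf n p)"
  shows "expectation (\<lambda>\<omega>. f (X \<omega>)) = measure_pmf.expectation (binomial_pmf n p) f"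
  using assms(1) by (simp add: assms(2)[symmetric] integral_distr)

text \<open>The binomial law has finite support, so every function of it is integrable.\<close>

lemma (in prob_space) integrable_binomial:
  fixes f :: "nat \<Rightarrow> 'b :: {banach, second_countable_topology}"
  assumes "X \<in> measurable M (count_space UNIV)"
    and "distr M (count_space UNIV) X = measure_pmf (binomial_pmf n p)" and "0 < p" "p < 1"
  shows "integrable M (\<lambda>\<omega>. f (X \<omega>))"
proof -
  have "integrable (distr M (count_space UNIV) X) f"
    unfolding assms(2) using assms(3,4) by auto
  then show ?thesis
    using assms(1) by (simp add: integrable_distr_eq)
qed

text \<open>Independence splits the characteristic function into two factors, each of the form
  treated in \<open>std_binomial_char_tendsto_compose\<close>.\<close>

lemma (in prob_space) char_binomial_combination:
  assumes ind: "indep_var (count_space UNIV) X (count_space UNIV) Y"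
    and X: "distr M (count_space UNIV) X = measure_pmf (binomial_pmf n p)"
    and Y: "distr M (count_space UNIV) Y = measure_pmf (binomial_pmf m p)"
  shows "char (distr M borel (\<lambda>\<omega>. a * std_binomial p n (X \<omega>) + b * std_binomial p m (Y \<omega>))) t
    = measure_pmf.expectation (binomial_pmf n p) (\<lambda>j. iexp (t * a * std_binomial p n j))
      * measure_pmf.expectation (binomial_pmf m p) (\<lambda>j. iexp (t * b * std_binomial p m j))"
proof -
  have rv [measurable]: "X \<in> measurable M (count_space UNIV)" "Y \<in> measurable M (count_space UNIV)"
    using indep_var_rv1[OF ind] indep_var_rv2[OF ind] by auto
  have "indep_var borel ((\<lambda>j. a * std_binomial p n j) \<circ> X) borel ((\<lambda>j. b * std_binomial p m j) \<circ> Y)"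
    by (rule indep_var_compose[OF ind]) auto
  from char_distr_add[OF this, of t] show ?thesis
    by (simp add: comp_def char_def integral_distr mult.assoc
        expectation_binomial[OF rv(1) X, symmetric] expectation_binomial[OF rv(2) Y, symmetric])
qed

text \<open>Near (1, 1) the Taylor error enters through the Lipschitz bound for \<open>iexp\<close>.
  Away from it the trivial bound 2 is absorbed as in Markov's inequality. Both bounds are multiples
  of the same first-order quantity, so taking expectations requires only first absolute
  moments.\<close>

lemma ratio_linearization_pointwise:
  fixes r s c p \<delta> \<eta> d t :: real and n m x y :: nat
  defines "u \<equiv> real x / (real n * p)" and "v \<equiv> real (x + y) / (real (n + m) * p)"
  assumes pos: "0 < p" "0 < n" "0 < m" "0 < \<delta>" "\<delta> < 1" "0 \<le> \<eta>"
    and lin: "\<And>u v. \<bar>u - 1\<bar> < \<delta> \<Longrightarrow> \<bar>v - 1\<bar> < \<delta> \<Longrightarrow>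
       \<bar>u powr s / v powr r - 1 - (s * (u - 1) - r * (v - 1))\<bar> \<le> \<eta> * (\<bar>u - 1\<bar> + \<bar>v - 1\<bar>)"
  shows "cmod (iexp (t * (d * (sqrt n * (ratio c r s x y /
             ((real n * p) powr s / (real (n + m) * p) powr r) - 1))))
           - iexp (t * (d * (sqrt n * (s * (u - 1) - r * (v - 1))))))
    \<le> (\<bar>t\<bar> * \<bar>d\<bar> * \<eta> + 2 / (\<delta> * sqrt n)) * (\<bar>sqrt n * (u - 1)\<bar> + \<bar>sqrt n * (v - 1)\<bar>)"
    (is "?lhs \<le> (?\<epsilon> + ?K) * ?S")
proof (cases "\<bar>u - 1\<bar> < \<delta> \<and> \<bar>v - 1\<bar> < \<delta>")
  case True
  \<comment> \<open>Positivity of \<open>v\<close> rules out a vanishing denominator, so the default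
    value \<open>c\<close> does not enter here; the far case uses only that \<open>iexp\<close> is
    unimodular.\<close>
  then have "0 < v" using pos by linarith
  then have xy: "x + y \<noteq> 0" unfolding v_def by (metis divide_eq_0_iff less_irrefl of_nat_0)
  then have eq: "ratio c r s x y / ((real n * p) powr s / (real (n + m) * p) powr r)
      = u powr s / v powr r"
    using pos xy by (auto simp: ratio_def u_def v_def powr_divide)
  let ?e = "u powr s / v powr r - 1 - (s * (u - 1) - r * (v - 1))"
  have "?lhs \<le> \<bar>t * (d * (sqrt n * (u powr s / v powr r - 1)))
      - t * (d * (sqrt n * (s * (u - 1) - r * (v - 1))))\<bar>"
    unfolding eq by (rule cmod_iexp_diff_le)
  also have "\<dots> = \<bar>t\<bar> * \<bar>d\<bar> * sqrt n * \<bar>?e\<bar>"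
    by (simp only: right_diff_distrib[symmetric] abs_mult) simp
  also have "\<dots> \<le> \<bar>t\<bar> * \<bar>d\<bar> * sqrt n * (\<eta> * (\<bar>u - 1\<bar> + \<bar>v - 1\<bar>))"
    using True by (intro mult_left_mono lin) auto
  also have "\<dots> = ?\<epsilon> * ?S"
    by (simp add: abs_mult distrib_left mult_ac)
  also have "\<dots> \<le> (?\<epsilon> + ?K) * ?S"
    using pos by (intro mult_right_mono) auto
  finally show ?thesis .
next
  case False
  \<comment> \<open>One of the two deviations is at least \<delta>, which makes \<open>?S\<close> at
    least \<open>\<delta> * sqrt n\<close> and hence \<open>?K * ?S\<close> at least 2.\<close>
  have "\<delta> * sqrt n \<le> (\<bar>u - 1\<bar> + \<bar>v - 1\<bar>) * sqrt n"
    using False by (intro mult_right_mono) auto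
  also have "\<dots> = ?S" by (simp add: abs_mult distrib_left mult_ac)
  finally have S: "\<delta> * sqrt n \<le> ?S" .
  have "?lhs \<le> 1 + 1"
    by (intro order.trans[OF norm_triangle_ineq4]) simp
  also have "\<dots> = ?K * (\<delta> * sqrt n)" using pos by simp
  also have "\<dots> \<le> (?\<epsilon> + ?K) * ?S"
    using S pos by (intro mult_mono) auto
  finally show ?thesis .
qed

text \<open>One statement serves all regimes: \<rho> is the limiting share of \<open>n\<close> in
  the total number of trials, and \<open>D\<close> is the limit of what remains of the normalization
  after \<open>sqrt n\<close> is split off. The variance is the sum of the squares of the limiting
  coefficients of the two standardized binomials.\<close>

lemma ratio_clt:
  fixes r s p c D \<rho> :: real
    and n m :: "nat \<Rightarrow> nat"
    and \<Omega> :: "nat \<Rightarrow> 'a measure"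
    and X Y :: "nat \<Rightarrow> 'a \<Rightarrow> nat"
  assumes p: "0 < p" "p < 1"
    and pos: "\<And>k. n k > 0" "\<And>k. m k > 0"
    and lim: "filterlim n at_top sequentially" "filterlim m at_top sequentially"
    and prob: "\<And>k. prob_space (\<Omega> k)"
    and ind: "\<And>k. prob_space.indep_var (\<Omega> k) (count_space UNIV) (X k) (count_space UNIV) (Y k)"
    and X: "\<And>k. distr (\<Omega> k) (count_space UNIV) (X k) = measure_pmf (binomial_pmf (n k) p)"
    and Y: "\<And>k. distr (\<Omega> k) (count_space UNIV) (Y k) = measure_pmf (binomial_pmf (m k) p)"
    and \<rho>: "(\<lambda>k. real (n k) / real (n k + m k)) \<longlonglongrightarrow> \<rho>"
    and D: "d \<longlonglongrightarrow> D"
  shows "weak_conv_m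
     (\<lambda>k. distr (\<Omega> k) borel (\<lambda>\<omega>. d k * (sqrt (n k) * (ratio c r s (X k \<omega>) (Y k \<omega>) /
         ((real (n k) * p) powr s / (real (n k + m k) * p) powr r) - 1))))
     (normal_law 0 (D\<^sup>2 * ((1 - p) / p) * ((s - r * \<rho>)\<^sup>2 + r\<^sup>2 * (\<rho> * (1 - \<rho>)))))"
    (is "weak_conv_m (\<lambda>k. distr (\<Omega> k) borel (?Z k)) (normal_law 0 ?var)")
proof -
  \<comment> \<open>The standard deviation of X / (n p) is \<sigma> / sqrt n.\<close>
  define \<sigma> where "\<sigma> = sqrt ((1 - p) / p)"
  have \<sigma>: "0 \<le> \<sigma>" "\<sigma>\<^sup>2 = (1 - p) / p" using p by (auto simp: \<sigma>_def)
  define w where "w k = real (n k) / real (n k + m k)" for k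
  \<comment> \<open>This is sqrt (n m) / (n + m), the weight of the second standardized binomial in
    \<open>V\<close> below.\<close>
  define h where "h k = sqrt (w k * (1 - w k))" for k
  have w: "0 \<le> w k" "w k \<le> 1" for k
    using pos[of k] by (auto simp: w_def divide_le_eq)
  have h: "0 \<le> h k" "h k \<le> 1" for k
    using w[of k] by (auto simp: h_def intro!: mult_le_one)
  have w_lim: "w \<longlonglongrightarrow> \<rho>" unfolding w_def[abs_def] by (rule \<rho>)
  have \<rho>01: "0 \<le> \<rho>" "\<rho> \<le> 1"
    using w by (auto intro: LIMSEQ_le_const[OF w_lim] LIMSEQ_le_const2[OF w_lim])
  define A where "A k \<omega> = std_binomial p (n k) (X k \<omega>)" for k \<omega>
  define B where "B k \<omega> = std_binomial p (m k) (Y k \<omega>)" for k \<omega>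
  define u where "u k \<omega> = real (X k \<omega>) / (real (n k) * p)" for k \<omega>
  define v where "v k \<omega> = real (X k \<omega> + Y k \<omega>) / (real (n k + m k) * p)" for k \<omega>
  have std: "\<sigma> * std_binomial p N j = (j - N * p) / (sqrt N * p)" if "0 < N" for N j :: nat
  proof -
    have "\<sigma> * std_binomial p N j = (sqrt (1 - p) / sqrt (1 - p)) * ((j - N * p) / (sqrt N * (sqrt p * sqrt p)))"
      unfolding std_binomial_def \<sigma>_def real_sqrt_mult real_sqrt_divide times_divide_times_eq
      by (simp only: mult_ac)
    then show ?thesis using p by simp
  qed
  have U: "sqrt (n k) * (u k \<omega> - 1) = \<sigma> * A k \<omega>" for k \<omega>
  proof -
    have "sqrt (n k) * sqrt (n k) = n k" by simp
    then show ?thesis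
      unfolding A_def std[OF pos(1)] using p pos[of k] by (simp add: u_def field_simps)
  qed
  \<comment> \<open>The deviation \<open>v - 1\<close> averages the relative deviations of X and Y
    with weights w and 1 - w. Scaling by sqrt n instead of sqrt m turns the second weight into (1 -
    w) sqrt (n / m), which is \<open>h\<close>. With the square roots \<open>N\<close> and
    \<open>M\<close> as variables the identity becomes rational.\<close>
  have V: "sqrt (n k) * (v k \<omega> - 1) = \<sigma> * (w k * A k \<omega> + h k * B k \<omega>)" for k \<omega>
  proof -
    define N M where "N = sqrt (n k)" and "M = sqrt (m k)"
    have NM: "real (n k) = N\<^sup>2" "real (m k) = M\<^sup>2" "0 < N" "0 < M"
      using pos[of k] by (auto simp: N_def M_def)
    have "0 < N\<^sup>2 + M\<^sup>2" using NM by (simp add: add_pos_pos)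
    have h': "h k = N * M / (N\<^sup>2 + M\<^sup>2)"
    proof -
      have "w k = N\<^sup>2 / (N\<^sup>2 + M\<^sup>2)" by (simp add: w_def NM)
      moreover have "1 - N\<^sup>2 / (N\<^sup>2 + M\<^sup>2) = M\<^sup>2 / (N\<^sup>2 + M\<^sup>2)"
        using NM(3) by (simp add: diff_divide_eq_iff)
      ultimately have "w k * (1 - w k) = (N * M / (N\<^sup>2 + M\<^sup>2))\<^sup>2"
        by (simp only:) (simp add: power_mult_distrib power_divide power2_eq_square)
      then show ?thesis
        using NM by (simp add: h_def)
    qed
    have "\<sigma> * (w k * A k \<omega> + h k * B k \<omega>) = w k * (\<sigma> * A k \<omega>) + h k * (\<sigma> * B k \<omega>)"
      by (simp add: algebra_simps)
    also have "\<dots> = N\<^sup>2 / (N\<^sup>2 + M\<^sup>2) * ((X k \<omega> - N\<^sup>2 * p) / (N * p))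
        + N * M / (N\<^sup>2 + M\<^sup>2) * ((Y k \<omega> - M\<^sup>2 * p) / (M * p))"
      unfolding A_def B_def std[OF pos(1)] std[OF pos(2)] h'
      using NM(3,4) by (simp add: w_def NM(1,2))
    also have "\<dots> = N * ((X k \<omega> + Y k \<omega>) / ((N\<^sup>2 + M\<^sup>2) * p) - 1)"
      using NM p \<open>0 < N\<^sup>2 + M\<^sup>2\<close>
      by (simp add: divide_simps) (simp add: algebra_simps power2_eq_square)
    also have "\<dots> = sqrt (n k) * (v k \<omega> - 1)"
      using NM(3) by (simp add: v_def NM(1,2))
    finally show ?thesis by simp
  qed
  define L where "L k \<omega> = d k * (sqrt (n k) * (s * (u k \<omega> - 1) - r * (v k \<omega> - 1)))" for k \<omega>
  define a where "a k = d k * \<sigma> * (s - r * w k)" for k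
  define b where "b k = - (d k * \<sigma> * r * h k)" for k
  have L: "L k \<omega> = a k * A k \<omega> + b k * B k \<omega>" for k \<omega>
  proof -
    have "L k \<omega> = d k * (s * (sqrt (n k) * (u k \<omega> - 1)) - r * (sqrt (n k) * (v k \<omega> - 1)))"
      by (simp add: L_def algebra_simps)
    then show ?thesis
      unfolding U V by (simp add: a_def b_def algebra_simps)
  qed
  have rv [measurable]: "X k \<in> measurable (\<Omega> k) (count_space UNIV)"
      "Y k \<in> measurable (\<Omega> k) (count_space UNIV)" for k
    using prob_space.indep_var_rv1[OF prob ind] prob_space.indep_var_rv2[OF prob ind] by auto
  have meas [measurable]: "?Z k \<in> borel_measurable (\<Omega> k)" "A k \<in> borel_measurable (\<Omega> k)"
      "B k \<in> borel_measurable (\<Omega> k)" "u k \<in> borel_measurable (\<Omega> k)"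
      "v k \<in> borel_measurable (\<Omega> k)" "L k \<in> borel_measurable (\<Omega> k)" for k
    unfolding A_def B_def u_def v_def L_def ratio_def by measurable
  have int: "integrable (\<Omega> k) (A k)" "integrable (\<Omega> k) (B k)" for k
    unfolding A_def B_def
    by (intro prob_space.integrable_binomial[OF prob rv(1) X p]
              prob_space.integrable_binomial[OF prob rv(2) Y p])+
  have moment: "(LINT \<omega>|\<Omega> k. \<bar>A k \<omega>\<bar>) \<le> 1" "(LINT \<omega>|\<Omega> k. \<bar>B k \<omega>\<bar>) \<le> 1" for k
    unfolding A_def B_def
    using prob_space.expectation_binomial[OF prob rv(1) X, of k "\<lambda>j. \<bar>std_binomial p (n k) j\<bar>"]
      prob_space.expectation_binomial[OF prob rv(2) Y, of k "\<lambda>j. \<bar>std_binomial p (m k) j\<bar>"]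
      std_binomial_abs_moment_le[OF p pos(1)] std_binomial_abs_moment_le[OF p pos(2)]
    by simp_all
  define S where "S k \<omega> = \<bar>sqrt (n k) * (u k \<omega> - 1)\<bar> + \<bar>sqrt (n k) * (v k \<omega> - 1)\<bar>" for k \<omega>
  have S_int: "integrable (\<Omega> k) (S k)" for k
    unfolding S_def U V using int by (intro Bochner_Integration.integrable_add) auto
  \<comment> \<open>The weights \<open>w k\<close> and \<open>h k\<close> are at most 1, so
    \<open>A\<close> is counted twice and \<open>B\<close> once, which gives the factor 3.\<close>
  have S_le: "(LINT \<omega>|\<Omega> k. S k \<omega>) \<le> 3 * \<sigma>" for k
  proof -
    have "(LINT \<omega>|\<Omega> k. S k \<omega>) \<le> (LINT \<omega>|\<Omega> k. \<sigma> * (2 * \<bar>A k \<omega>\<bar> + \<bar>B k \<omega>\<bar>))"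
    proof (intro integral_mono S_int)
      fix \<omega>
      have "\<bar>w k * A k \<omega> + h k * B k \<omega>\<bar> \<le> w k * \<bar>A k \<omega>\<bar> + h k * \<bar>B k \<omega>\<bar>"
        using w h abs_triangle_ineq[of "w k * A k \<omega>" "h k * B k \<omega>"] by (simp add: abs_mult)
      also have "\<dots> \<le> 1 * \<bar>A k \<omega>\<bar> + 1 * \<bar>B k \<omega>\<bar>"
        using w h by (intro add_mono mult_right_mono) auto
      finally have "\<sigma> * (\<bar>A k \<omega>\<bar> + \<bar>w k * A k \<omega> + h k * B k \<omega>\<bar>)
          \<le> \<sigma> * (\<bar>A k \<omega>\<bar> + (\<bar>A k \<omega>\<bar> + \<bar>B k \<omega>\<bar>))"
        using \<sigma> by (intro mult_left_mono add_left_mono) auto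
      then show "S k \<omega> \<le> \<sigma> * (2 * \<bar>A k \<omega>\<bar> + \<bar>B k \<omega>\<bar>)"
        unfolding S_def U V abs_mult abs_of_nonneg[OF \<sigma>(1)] by (simp add: distrib_left)
    qed (use int in auto)
    also have "\<dots> = \<sigma> * (2 * (LINT \<omega>|\<Omega> k. \<bar>A k \<omega>\<bar>) + (LINT \<omega>|\<Omega> k. \<bar>B k \<omega>\<bar>))"
      using int by simp
    also have "\<dots> \<le> \<sigma> * (2 * 1 + 1)"
      using \<sigma> moment by (intro mult_left_mono add_mono) auto
    finally show ?thesis by (simp add: mult.commute)
  qed
  show ?thesis
  proof (rule levy_continuity)
    show "real_distribution (distr (\<Omega> k) borel (?Z k))" for k
      by (intro prob_space.real_distribution_distr prob meas)
    have var: "0 \<le> ?var" using p \<rho>01 by auto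
    then show "real_distribution (normal_law 0 ?var)" by (rule real_distribution_normal_law)
    fix t
    \<comment> \<open>The characteristic function of the linear part \<open>L\<close> has the right
      limit, and that of the ratio differs from it by a null sequence.\<close>
    let ?\<phi> = "\<lambda>k. char (distr (\<Omega> k) borel (?Z k)) t"
    let ?\<chi> = "\<lambda>k. char (distr (\<Omega> k) borel (L k)) t"
    have "?\<chi> \<longlonglongrightarrow> char (normal_law 0 ?var) t"
    proof -
      have ab: "(\<lambda>k. t * a k) \<longlonglongrightarrow> t * (D * \<sigma> * (s - r * \<rho>))"
          "(\<lambda>k. t * b k) \<longlonglongrightarrow> t * - (D * \<sigma> * r * sqrt (\<rho> * (1 - \<rho>)))"
        unfolding a_def b_def h_def by (intro tendsto_intros D w_lim)+
      have "?\<chi> k = measure_pmf.expectation (binomial_pmf (n k) p) (\<lambda>j. iexp (t * a k * std_binomial p (n k) j))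
          * measure_pmf.expectation (binomial_pmf (m k) p) (\<lambda>j. iexp (t * b k * std_binomial p (m k) j))" for k
        unfolding L A_def B_def
        by (rule prob_space.char_binomial_combination[OF prob ind X Y])
      \<comment> \<open>The squared coefficients add up to the claimed variance; \<sigma>^2 accounts
        for (1 - p) / p.\<close>
      moreover have "exp (- ((t * (D * \<sigma> * (s - r * \<rho>)))\<^sup>2 / 2))
          * exp (- ((t * - (D * \<sigma> * r * sqrt (\<rho> * (1 - \<rho>))))\<^sup>2 / 2)) = exp (- (?var * t\<^sup>2 / 2))"
        unfolding exp_add[symmetric] \<sigma>(2)[symmetric]
        using \<rho>01 by (simp add: power_mult_distrib) (simp add: algebra_simps add_divide_distrib diff_divide_distrib)
      ultimately show ?thesis
        using tendsto_mult[OF std_binomial_char_tendsto_compose[OF p pos(1) lim(1) ab(1)]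
            std_binomial_char_tendsto_compose[OF p pos(2) lim(2) ab(2)]]
        by (simp only: char_normal_law[OF var] of_real_mult[symmetric])
    qed
    moreover have "(\<lambda>k. ?\<phi> k - ?\<chi> k) \<longlonglongrightarrow> 0"
    proof (rule tendstoI)
      fix e :: real assume e: "0 < e"
      \<comment> \<open>With linearization accuracy e / (2 K) the error bound has a limit strictly
        below e. The final summand 1 keeps \<open>K\<close> positive even when \<open>t\<close> is
        0.\<close>
      define K where "K = \<bar>t\<bar> * (\<bar>D\<bar> + 1) * (3 * \<sigma>) + 1"
      have K: "0 < K" using \<sigma> by (auto simp: K_def intro: add_nonneg_pos)
      obtain \<delta> where \<delta>: "0 < \<delta>" "\<delta> < 1" and lin:
        "\<And>x y. \<bar>x - 1\<bar> < \<delta> \<Longrightarrow> \<bar>y - 1\<bar> < \<delta> \<Longrightarrow>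
         \<bar>x powr s / y powr r - 1 - (s * (x - 1) - r * (y - 1))\<bar> \<le> e / (2 * K) * (\<bar>x - 1\<bar> + \<bar>y - 1\<bar>)"
        using powr_ratio_linearization[of "e / (2 * K)" s r] e K by auto
      let ?c = "\<lambda>k. \<bar>t\<bar> * \<bar>d k\<bar> * (e / (2 * K)) + 2 / (\<delta> * sqrt (n k))"
      have le: "cmod (?\<phi> k - ?\<chi> k) \<le> ?c k * (3 * \<sigma>)" for k
      proof -
        interpret prob_space "\<Omega> k" by (rule prob)
        have i: "integrable (\<Omega> k) (\<lambda>\<omega>. iexp (t * ?Z k \<omega>))" "integrable (\<Omega> k) (\<lambda>\<omega>. iexp (t * L k \<omega>))"
          by (intro integrable_iexp; simp)+
        have "cmod (?\<phi> k - ?\<chi> k) = cmod (CLINT \<omega>|\<Omega> k. iexp (t * ?Z k \<omega>) - iexp (t * L k \<omega>))"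
          using i by (simp add: char_def integral_distr Bochner_Integration.integral_diff)
        also have "\<dots> \<le> (LINT \<omega>|\<Omega> k. cmod (iexp (t * ?Z k \<omega>) - iexp (t * L k \<omega>)))"
          by (rule integral_norm_bound)
        also have "\<dots> \<le> (LINT \<omega>|\<Omega> k. ?c k * S k \<omega>)"
          using i e K S_int \<delta> p pos unfolding S_def L_def u_def v_def
          by (intro integral_mono ratio_linearization_pointwise lin) auto
        also have "\<dots> \<le> ?c k * (3 * \<sigma>)"
          using S_le[of k] e K \<delta> by (simp add: mult_left_mono)
        finally show ?thesis .
      qed
      have "(\<lambda>k. ?c k * (3 * \<sigma>)) \<longlonglongrightarrow> (\<bar>t\<bar> * \<bar>D\<bar> * (e / (2 * K)) + 0) * (3 * \<sigma>)"
      proof (intro tendsto_intros D)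
        have "filterlim (\<lambda>k. \<delta> * sqrt (n k)) at_top sequentially"
          using \<delta> lim(1)
          by (intro filterlim_tendsto_pos_mult_at_top[OF tendsto_const] filterlim_compose[OF sqrt_at_top]
              filterlim_compose[OF filterlim_real_sequentially])
        then show "(\<lambda>k. 2 / (\<delta> * sqrt (n k))) \<longlonglongrightarrow> 0"
          by (intro tendsto_divide_0[OF tendsto_const] filterlim_at_top_imp_at_infinity)
      qed
      moreover have "(\<bar>t\<bar> * \<bar>D\<bar> * (e / (2 * K)) + 0) * (3 * \<sigma>) < e"
      proof -
        have "\<bar>t\<bar> * \<bar>D\<bar> * (3 * \<sigma>) \<le> \<bar>t\<bar> * (\<bar>D\<bar> + 1) * (3 * \<sigma>)"
          using \<sigma> by (intro mult_right_mono mult_left_mono) auto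
        also have "\<dots> < K" by (simp add: K_def)
        also have "\<dots> < 2 * K" using K by simp
        finally have "\<bar>t\<bar> * \<bar>D\<bar> * (3 * \<sigma>) < 2 * K" .
        then have "\<bar>t\<bar> * \<bar>D\<bar> * (3 * \<sigma>) * (e / (2 * K)) < 2 * K * (e / (2 * K))"
          using e K by (intro mult_strict_right_mono) auto
        then show ?thesis using K by (simp add: mult_ac)
      qed
      ultimately have "\<forall>\<^sub>F k in sequentially. ?c k * (3 * \<sigma>) < e"
        by (rule order_tendstoD)
      then show "\<forall>\<^sub>F k in sequentially. dist (?\<phi> k - ?\<chi> k) 0 < e"
        by eventually_elim (use le in \<open>auto intro: le_less_trans\<close>)
    qed
    ultimately show "?\<phi> \<longlonglongrightarrow> char (normal_law 0 ?var) t"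
      using tendsto_add by fastforce
  qed
qed

section \<open>The three growth regimes\<close>

theorem theorem1:
  fixes r s p c :: real
    and n m :: "nat \<Rightarrow> nat"
    and \<Omega> :: "nat \<Rightarrow> 'a measure"
    and X Y :: "nat \<Rightarrow> 'a \<Rightarrow> nat"
    and R :: "nat \<Rightarrow> 'a \<Rightarrow> real"
  assumes "r > 0" and "s > 0" and "0 < p" and "p < 1"
    and "\<And>k. n k > 0" and "\<And>k. m k > 0"
    and "filterlim n at_top sequentially" and "filterlim m at_top sequentially"
    and "\<And>k. prob_space (\<Omega> k)"
    and "\<And>k. prob_space.indep_var (\<Omega> k) (count_space UNIV) (X k) (count_space UNIV) (Y k)"
    and "\<And>k. distr (\<Omega> k) (count_space UNIV) (X k) = measure_pmf (binomial_pmf (n k) p)"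
    and "\<And>k. distr (\<Omega> k) (count_space UNIV) (Y k) = measure_pmf (binomial_pmf (m k) p)"
    and R_def: "\<And>k \<omega>. R k \<omega> = ratio c r s (X k \<omega>) (Y k \<omega>)"
  shows
    "(filterlim (\<lambda>k. real (m k) / real (n k)) at_top sequentially \<and>
      (\<lambda>k. real (m k) * ln (real (m k)) * real (n k) powr (- 3 / 2)) \<longlonglongrightarrow> 0 \<longrightarrow>
      weak_conv_m
        (\<lambda>k. distr (\<Omega> k) borel (\<lambda>\<omega>. real (m k) powr r / real (n k) powr (s - 1 / 2) *
           (R k \<omega> - real (n k) powr s / real (n k + m k) powr r * p powr (s - r))))
        (normal_law 0 (p powr (2 * (s - r) - 1) * (1 - p) * s\<^sup>2)))
   \<and> (\<forall>\<alpha>>0. (\<lambda>k. real (m k) / real (n k)) \<longlonglongrightarrow> \<alpha> \<longrightarrow>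
      weak_conv_m
        (\<lambda>k. distr (\<Omega> k) borel (\<lambda>\<omega>. real (n k) powr (r - s + 1 / 2) *
           (R k \<omega> - real (n k) powr s / real (n k + m k) powr r * p powr (s - r))))
        (normal_law 0 (p powr (2 * (s - r) - 1) * (1 - p) *
           (((s * (1 + \<alpha>) - r)\<^sup>2 + \<alpha> * r\<^sup>2) / (1 + \<alpha>) powr (2 * (r + 1))))))
   \<and> ((\<lambda>k. real (m k) / real (n k)) \<longlonglongrightarrow> 0 \<longrightarrow>
      weak_conv_m
        (\<lambda>k. distr (\<Omega> k) borel (\<lambda>\<omega>. real (n k) powr (r - s + 1 / 2) *
           (R k \<omega> - real (n k) powr s / real (n k + m k) powr r * p powr (s - r))))
        (normal_law 0 (p powr (2 * (s - r) - 1) * (1 - p) * (s - r)\<^sup>2)))"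
proof (intro conjI allI impI)
  define d where "d k = real (n k) / real (n k + m k)" for k
  define C where "C k = (real (n k) * p) powr s / (real (n k + m k) * p) powr r" for k
  have C_pos: "0 < C k" for k
    using assms(3) assms(5)[of k] by (simp add: C_def)
  have C: "real (n k) powr s / real (n k + m k) powr r * p powr (s - r) = C k" for k
    using assms(3) by (simp add: C_def powr_mult powr_diff)
  have sqrt_n: "sqrt (n k) = n k powr (1 / 2)" for k by (simp add: powr_half_sqrt)
  \<comment> \<open>Factoring out the centering \<open>C k\<close> shows what a normalization
    \<open>f\<close> must satisfy: \<open>f k * C k\<close> is \<open>sqrt (n k)\<close> times a
    convergent \<open>g k\<close>. Each regime then supplies its \<open>g\<close> and the matching
    form of the variance.\<close>
  have clt: "weak_conv_m (\<lambda>k. distr (\<Omega> k) borel (\<lambda>\<omega>. f k * (R k \<omega> - C k))) (normal_law 0 V)"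
    if \<rho>: "d \<longlonglongrightarrow> \<rho>" and g: "\<And>k. f k * C k = g k * sqrt (n k)" "g \<longlonglongrightarrow> D"
      and V: "V = D\<^sup>2 * ((1 - p) / p) * ((s - r * \<rho>)\<^sup>2 + r\<^sup>2 * (\<rho> * (1 - \<rho>)))"
    for \<rho> f g D V
  proof -
    have "f k * (R k \<omega> - C k) = g k * (sqrt (n k) * (ratio c r s (X k \<omega>) (Y k \<omega>) / C k - 1))" for k \<omega>
    proof -
      have "f k * (R k \<omega> - C k) = f k * C k * (R k \<omega> / C k - 1)"
        using C_pos[of k] by (simp add: field_simps)
      then show ?thesis by (simp add: g R_def)
    qed
    then show ?thesis
      unfolding V C_def using ratio_clt[OF assms(3-12) \<rho>[unfolded d_def] g(2)] by simp
  qed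
  have p2: "(p powr (s - r))\<^sup>2 * ((1 - p) / p) = p powr (2 * (s - r) - 1) * (1 - p)"
  proof -
    have "2 * (s - r) - 1 = (s - r) + (s - r) - 1" by simp
    then have "p powr (2 * (s - r) - 1) = p powr (s - r) * p powr (s - r) / p powr 1"
      by (simp only: powr_diff[of p "(s - r) + (s - r)" 1] powr_add)
    then show ?thesis
      using assms(3) by (simp add: power2_eq_square)
  qed
  \<comment> \<open>The regimes are given through m / n, whereas \<open>clt\<close> asks for the
    limit of n / (n + m).\<close>
  have d_alt: "d k = 1 / (1 + real (m k) / real (n k))" for k
    using assms(5)[of k] by (simp add: d_def field_simps)
  {
    assume *: "filterlim (\<lambda>k. real (m k) / real (n k)) at_top sequentially \<and>
      (\<lambda>k. real (m k) * ln (real (m k)) * real (n k) powr (- 3 / 2)) \<longlonglongrightarrow> 0"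
    then have "filterlim (\<lambda>k. 1 + real (m k) / real (n k)) at_top sequentially"
      by (intro filterlim_tendsto_add_at_top[OF tendsto_const]) simp
    then have d: "d \<longlonglongrightarrow> 0"
      unfolding d_alt by (intro tendsto_divide_0[OF tendsto_const] filterlim_at_top_imp_at_infinity)
    show "weak_conv_m
        (\<lambda>k. distr (\<Omega> k) borel (\<lambda>\<omega>. real (m k) powr r / real (n k) powr (s - 1 / 2) *
           (R k \<omega> - real (n k) powr s / real (n k + m k) powr r * p powr (s - r))))
        (normal_law 0 (p powr (2 * (s - r) - 1) * (1 - p) * s\<^sup>2))"
      unfolding C
    proof (rule clt[OF d])
      \<comment> \<open>Here the normalization times the centering is (m / (n + m))^r p^(s - r) sqrt
        n, and m / (n + m) = 1 - d tends to 1. With \<rho> = 0 the variance bracket reduces to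
        s^2.\<close>
      have "(\<lambda>k. (1 - d k) powr r * p powr (s - r)) \<longlonglongrightarrow> (1 - 0) powr r * p powr (s - r)"
        by (intro tendsto_intros d) auto
      then show "(\<lambda>k. (1 - d k) powr r * p powr (s - r)) \<longlonglongrightarrow> p powr (s - r)" by simp
      show "real (m k) powr r / real (n k) powr (s - 1 / 2) * C k
          = (1 - d k) powr r * p powr (s - r) * sqrt (n k)" for k
      proof -
        have "1 - d k = m k / real (n k + m k)"
          using assms(5)[of k] by (simp add: d_def field_simps)
        then show ?thesis
          using assms(5,6)[of k] unfolding C[symmetric] sqrt_n
          by (simp add: powr_divide powr_diff)
      qed
    qed (simp only: p2, simp)
  }
  \<comment> \<open>Regimes (ii) and (iii) share their normalization, so they are treated together
    by admitting \<alpha> = 0.\<close>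
  have bounded: "weak_conv_m
        (\<lambda>k. distr (\<Omega> k) borel (\<lambda>\<omega>. real (n k) powr (r - s + 1 / 2) *
           (R k \<omega> - real (n k) powr s / real (n k + m k) powr r * p powr (s - r))))
        (normal_law 0 (p powr (2 * (s - r) - 1) * (1 - p) *
           (((s * (1 + \<alpha>) - r)\<^sup>2 + \<alpha> * r\<^sup>2) / (1 + \<alpha>) powr (2 * (r + 1)))))"
    if \<alpha>: "0 \<le> \<alpha>" "(\<lambda>k. real (m k) / real (n k)) \<longlonglongrightarrow> \<alpha>" for \<alpha>
    unfolding C
  proof (rule clt)
    show d: "d \<longlonglongrightarrow> 1 / (1 + \<alpha>)"
      unfolding d_alt using \<alpha> by (intro tendsto_intros) auto
    show "(\<lambda>k. d k powr r * p powr (s - r)) \<longlonglongrightarrow> (1 / (1 + \<alpha>)) powr r * p powr (s - r)"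
      using \<alpha> by (intro tendsto_intros d) auto
    \<comment> \<open>The power n^(r - s) cancels n^s against the centering and leaves (n / (n +
      m))^r.\<close>
    show "real (n k) powr (r - s + 1 / 2) * C k = d k powr r * p powr (s - r) * sqrt (n k)" for k
      using assms(5)[of k] unfolding C[symmetric] sqrt_n d_def
      by (simp add: powr_divide powr_diff powr_add)
    \<comment> \<open>The square of the limit of \<open>g\<close> contributes b^(-2 r) and the
      variance bracket contributes b^(-2); together they form the denominator b^(2 (r + 1)).\<close>
    define b where "b = 1 + \<alpha>"
    have b: "0 < b" "\<alpha> = b - 1" using \<alpha> by (auto simp: b_def)
    have "b powr (2 * (r + 1)) = (b powr r)\<^sup>2 * b\<^sup>2"
    proof -
      have "2 * (r + 1) = r + r + 2" by simp
      then have "b powr (2 * (r + 1)) = b powr r * b powr r * b powr 2"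
        by (simp only: powr_add)
      then show ?thesis using b by (simp add: power2_eq_square)
    qed
    moreover have "((1 / b) powr r)\<^sup>2 = 1 / (b powr r)\<^sup>2"
      using b by (simp add: powr_divide power_divide)
    moreover have "(s - r * (1 / b))\<^sup>2 + r\<^sup>2 * (1 / b * (1 - 1 / b)) = ((s * b - r)\<^sup>2 + \<alpha> * r\<^sup>2) / b\<^sup>2"
      using b(1) unfolding b(2) by (simp add: field_simps power2_eq_square)
    ultimately show "p powr (2 * (s - r) - 1) * (1 - p) *
           (((s * (1 + \<alpha>) - r)\<^sup>2 + \<alpha> * r\<^sup>2) / (1 + \<alpha>) powr (2 * (r + 1)))
        = ((1 / (1 + \<alpha>)) powr r * p powr (s - r))\<^sup>2 * ((1 - p) / p) *
          ((s - r * (1 / (1 + \<alpha>)))\<^sup>2 + r\<^sup>2 * (1 / (1 + \<alpha>) * (1 - 1 / (1 + \<alpha>))))"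
      unfolding b_def[symmetric] power_mult_distrib p2[symmetric] by simp
  qed
  show "weak_conv_m
        (\<lambda>k. distr (\<Omega> k) borel (\<lambda>\<omega>. real (n k) powr (r - s + 1 / 2) *
           (R k \<omega> - real (n k) powr s / real (n k + m k) powr r * p powr (s - r))))
        (normal_law 0 (p powr (2 * (s - r) - 1) * (1 - p) *
           (((s * (1 + \<alpha>) - r)\<^sup>2 + \<alpha> * r\<^sup>2) / (1 + \<alpha>) powr (2 * (r + 1)))))"
    if "0 < \<alpha>" "(\<lambda>k. real (m k) / real (n k)) \<longlonglongrightarrow> \<alpha>" for \<alpha>
    using bounded[of \<alpha>] that by simp
  \<comment> \<open>At \<alpha> = 0 the denominator is a power of 1 and the numerator is (s -
    r)^2.\<close>
  show "weak_conv_m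
        (\<lambda>k. distr (\<Omega> k) borel (\<lambda>\<omega>. real (n k) powr (r - s + 1 / 2) *
           (R k \<omega> - real (n k) powr s / real (n k + m k) powr r * p powr (s - r))))
        (normal_law 0 (p powr (2 * (s - r) - 1) * (1 - p) * (s - r)\<^sup>2))"
    if "(\<lambda>k. real (m k) / real (n k)) \<longlonglongrightarrow> 0"
    using bounded[of 0] that by simp
qed

end
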